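(* Let $(X,\delta)$ be a hyperconvex diversity and $(X,d)$ its induced metric space. Suppose that for every finite set $A=\{x_1,\ldots,x_n\}\in\langle X\rangle$ (with $x_1,\dots,x_n$ pairwise distinct, so $n=|A|$) we have $$(|A|-1)\cdot\delta(A)\le\sum_{1\le i<j\le n}d(x_i,x_j).$$ Then $(X,d)$ is a hyperconvex metric space.
   Context: For a set $X$, $\langle X\rangle$ denotes the set of finite subsets of $X$. A diversity is a pair $(X,\delta)$ with $\delta\colon\langle X\rangle\to\mathbb{R}$ such that (1) $\delta(A)\ge 0$ for all $A\in\langle X\rangle$, and $\delta(A)=0$ if and only if $|A|\le 1$; (2) for all $A,B,C\in\langle X\rangle$ with $B\ne\emptyset$, $\delta(A\cup C)\le\delta(A\cup B)+\delta(B\cup C)$. The induced metric on $X$ is $d(x,y)=\delta(\{x,y\})$. A diversity $(X,\delta)$ is hyperconvex if for every $r\colon\langle X\rangle\to\mathbb{R}$ with $r(\emptyset)=0$ and $\delta\left(\bigcup_{A\in\mathcal{A}}A\right)\le\sum_{A\in\mathcal{A}}r(A)$ for all finite $\mathcal{A}\subseteq\langle X\rangle$, there is $z\in X$ such that $\delta(\{z\}\cup Y)\le r(Y)$ for all finite $Y\subseteq X$. A metric space $(M,d)$ is hyperconvex if for every family $\{x_\alpha\}$ of points of $M$ and every family $\{r_\alpha\}$ of nonnegative numbers with $d(x_\alpha,x_\beta)\le r_\alpha+r_\beta$ for all $\alpha,\beta$, the closed balls $\bar B(x_\alpha,r_\alpha)$ have a common point. *)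

theory Defs
  imports "HOL-Analysis.Analysis"
begin

text \<open>The set of finite subsets of \<open>X\<close> is \<^const>\<open>Fpow\<close>; the values of \<open>\<delta>\<close> on other sets are irrelevant.\<close>

locale diversity =
  fixes X :: "'a set" and \<delta> :: "'a set \<Rightarrow> real"
  assumes nonneg: "A \<in> Fpow X \<Longrightarrow> 0 \<le> \<delta> A"
    and zero_iff: "A \<in> Fpow X \<Longrightarrow> \<delta> A = 0 \<longleftrightarrow> card A \<le> 1"
    and triangle: "\<lbrakk>A \<in> Fpow X; B \<in> Fpow X; C \<in> Fpow X; B \<noteq> {}\<rbrakk>
      \<Longrightarrow> \<delta> (A \<union> C) \<le> \<delta> (A \<union> B) + \<delta> (B \<union> C)"

text \<open>\<^locale>\<open>Metric_space\<close> requires nonnegativity and symmetry also off the carrier, hence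
  the value 0 there.\<close>

definition induced_metric :: "'a set \<Rightarrow> ('a set \<Rightarrow> real) \<Rightarrow> 'a \<Rightarrow> 'a \<Rightarrow> real" where
  "induced_metric X \<delta> x y = (if x \<in> X \<and> y \<in> X then \<delta> {x, y} else 0)"

lemma (in diversity) Metric_space_induced_metric: "Metric_space X (induced_metric X \<delta>)"
proof
  show "0 \<le> induced_metric X \<delta> x y" for x y
    by (auto simp: induced_metric_def Fpow_def intro!: nonneg)
  show "induced_metric X \<delta> x y = induced_metric X \<delta> y x" for x y
    by (simp add: induced_metric_def insert_commute)
  show "induced_metric X \<delta> x y = 0 \<longleftrightarrow> x = y" if "x \<in> X" "y \<in> X" for x y
    using that zero_iff[of "{x, y}"] by (auto simp: induced_metric_def Fpow_def card_insert_if)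
  show "induced_metric X \<delta> x z \<le> induced_metric X \<delta> x y + induced_metric X \<delta> y z"
    if "x \<in> X" "y \<in> X" "z \<in> X" for x y z
    using that triangle[of "{x}" "{y}" "{z}"] by (simp add: induced_metric_def Fpow_def insert_commute)
qed

locale hyperconvex_diversity = diversity X \<delta> for X :: "'a set" and \<delta> :: "'a set \<Rightarrow> real" +
  assumes hyperconvex:
    "\<And>r :: 'a set \<Rightarrow> real.
      \<lbrakk>r {} = 0; \<And>\<A>. \<lbrakk>finite \<A>; \<A> \<subseteq> Fpow X\<rbrakk> \<Longrightarrow> \<delta> (\<Union>\<A>) \<le> (\<Sum>A\<in>\<A>. r A)\<rbrakk>
      \<Longrightarrow> \<exists>z\<in>X. \<forall>Y\<in>Fpow X. \<delta> ({z} \<union> Y) \<le> r Y"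

text \<open>HOL cannot quantify over all index types inside a definition, so a family of points and
  radii is given by the set \<open>F\<close> of its pairs; this loses no generality, see
  \<open>hyperconvex_indexed\<close> below. The empty family is allowed and forces \<open>M\<close> to be nonempty.\<close>

locale hyperconvex_metric_space = Metric_space M d
  for M :: "'a set" and d :: "'a \<Rightarrow> 'a \<Rightarrow> real" +
  assumes hyperconvex:
    "\<lbrakk>F \<subseteq> M \<times> {0..}; \<And>x \<rho> y \<sigma>. \<lbrakk>(x, \<rho>) \<in> F; (y, \<sigma>) \<in> F\<rbrakk> \<Longrightarrow> d x y \<le> \<rho> + \<sigma>\<rbrakk>
      \<Longrightarrow> \<exists>z\<in>M. \<forall>(x, \<rho>)\<in>F. z \<in> mcball x \<rho>"

lemma (in hyperconvex_metric_space) hyperconvex_indexed: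
  fixes x :: "'i \<Rightarrow> 'a" and \<rho> :: "'i \<Rightarrow> real"
  assumes "\<And>i. i \<in> I \<Longrightarrow> x i \<in> M" "\<And>i. i \<in> I \<Longrightarrow> 0 \<le> \<rho> i"
    and "\<And>i j. \<lbrakk>i \<in> I; j \<in> I\<rbrakk> \<Longrightarrow> d (x i) (x j) \<le> \<rho> i + \<rho> j"
  shows "\<exists>z\<in>M. \<forall>i\<in>I. z \<in> mcball (x i) (\<rho> i)"
proof -
  have "\<exists>z\<in>M. \<forall>(y, \<sigma>)\<in>(\<lambda>i. (x i, \<rho> i)) ` I. z \<in> mcball y \<sigma>"
    by (rule hyperconvex) (use assms in auto)
  then show ?thesis by auto
qed

end

theory Submission
  imports Defs
begin

text \<open>The function \<open>\<rho> y = inf {\<sigma> + d x y | (x, \<sigma>) \<in> F}\<close> extends the radii of a family \<open>F\<close> of pairwise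
  compatible balls to all points, with \<open>d y y' \<le> \<rho> y + \<rho> y'\<close>. Summing this over the pairs of a set
  \<open>A\<close> counts every point \<open>|A| - 1\<close> times, so the hypothesis on \<open>\<delta>\<close> gives \<open>\<delta> A \<le> \<Sum>x\<in>A. \<rho> x\<close>. Hence
  hyperconvexity of the diversity applies to \<open>r A = \<Sum>x\<in>A. \<rho> x\<close>, and the point it yields is in all
  the balls, by looking at singletons.\<close>

text \<open>Going from \<open>n\<close> to \<open>Suc n\<close> adds the pairs
  \<open>(i, Suc n)\<close> with \<open>1 \<le> i \<le> n\<close>. They contribute each old value
  once more and \<open>f (Suc n)\<close> exactly \<open>n\<close> times.\<close>

lemma sum_ordered_pairs_add:
  fixes f :: "nat \<Rightarrow> real"
  shows "(\<Sum>(i, j)\<in>{(i, j). 1 \<le> i \<and> i < j \<and> j \<le> n}. f i + f j) = (real n - 1) * (\<Sum>i=1..n. f i)"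
proof (induction n)
  case 0
  show ?case
    by (simp, rule sum.neutral) auto
next
  case (Suc n)
  let ?P = "\<lambda>n. {(i, j). 1 \<le> i \<and> i < j \<and> j \<le> (n::nat)}"
  have fin: "finite (?P n)"
    by (rule finite_subset[of _ "{..n} \<times> {..n}"]) auto
  have "?P (Suc n) = ?P n \<union> {1..n} \<times> {Suc n}"
    by auto
  moreover have "?P n \<inter> {1..n} \<times> {Suc n} = {}"
    by auto
  ultimately have "(\<Sum>(i, j)\<in>?P (Suc n). f i + f j)
      = (\<Sum>(i, j)\<in>?P n. f i + f j) + (\<Sum>(i, j)\<in>{1..n} \<times> {Suc n}. f i + f j)"
    using fin by (simp add: sum.union_disjoint)
  also have "(\<Sum>(i, j)\<in>{1..n} \<times> {Suc n}. f i + f j) = (\<Sum>i=1..n. f i + f (Suc n))"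
    by (simp flip: sum.cartesian_product)
  finally show ?case
    using Suc by (simp add: sum.distrib algebra_simps)
qed

text \<open>A point lying in several members counts once on the left but repeatedly on the right.
  This turns a bound by the radii over a union into the bound over a family that diversity
  hyperconvexity demands.\<close>

lemma sum_Union_le:
  fixes f :: "'a \<Rightarrow> real"
  assumes "finite \<A>" "\<And>A. A \<in> \<A> \<Longrightarrow> finite A" "\<And>x. x \<in> \<Union>\<A> \<Longrightarrow> 0 \<le> f x"
  shows "sum f (\<Union>\<A>) \<le> (\<Sum>A\<in>\<A>. sum f A)"
  using assms
proof (induction \<A> rule: finite_induct)
  case (insert A \<A>)
  have "0 \<le> sum f (A \<inter> \<Union>\<A>)"
    using insert.prems by (intro sum_nonneg) auto
  moreover have "sum f (A \<union> \<Union>\<A>) = sum f A + sum f (\<Union>\<A>) - sum f (A \<inter> \<Union>\<A>)"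
    using insert by (intro sum_Un) auto
  moreover have "sum f (\<Union>\<A>) \<le> (\<Sum>A\<in>\<A>. sum f A)"
    using insert.prems by (intro insert.IH) auto
  ultimately show ?case
    using insert.hyps by simp
qed simp

lemma (in diversity) le_sum_radii:
  assumes A: "A \<in> Fpow X"
    and pairs: "\<And>(n :: nat) x. bij_betw x {1..n} A \<Longrightarrow> (real (card A) - 1) * \<delta> A
      \<le> (\<Sum>(i, j)\<in>{(i, j). 1 \<le> i \<and> i < j \<and> j \<le> n}. induced_metric X \<delta> (x i) (x j))"
    and \<rho>: "\<And>x. x \<in> A \<Longrightarrow> 0 \<le> \<rho> x"
      "\<And>x y. \<lbrakk>x \<in> A; y \<in> A\<rbrakk> \<Longrightarrow> induced_metric X \<delta> x y \<le> \<rho> x + \<rho> y"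
  shows "\<delta> A \<le> sum \<rho> A"
\<comment> \<open>The factor \<open>card A - 1\<close> can be cancelled only when it is positive; on
  smaller sets \<delta> vanishes.\<close>
proof (cases "card A \<le> 1")
  case True
  then show ?thesis
    using zero_iff[OF A] by (simp add: sum_nonneg \<rho>)
next
  case False
  have "finite A"
    using A by (simp add: Fpow_def)
  then obtain x where x: "bij_betw x {1..card A} A"
    using ex_bij_betw_nat_finite_1 by blast
  then have xA: "x i \<in> A" if "1 \<le> i" "i \<le> card A" for i
    using that by (auto simp: bij_betw_def)
  have "(real (card A) - 1) * \<delta> A
      \<le> (\<Sum>(i, j)\<in>{(i, j). 1 \<le> i \<and> i < j \<and> j \<le> card A}. induced_metric X \<delta> (x i) (x j))"
    by (rule pairs) (rule x)
  also have "\<dots> \<le> (\<Sum>(i, j)\<in>{(i, j). 1 \<le> i \<and> i < j \<and> j \<le> card A}. \<rho> (x i) + \<rho> (x j))"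
    by (rule sum_mono) (auto intro!: \<rho> xA)
  also have "\<dots> = (real (card A) - 1) * (\<Sum>i=1..card A. \<rho> (x i))"
    by (rule sum_ordered_pairs_add)
  also have "(\<Sum>i=1..card A. \<rho> (x i)) = sum \<rho> A"
    by (rule sum.reindex_bij_betw) (rule x)
  finally show ?thesis
    using False by simp
qed

text \<open>For \<open>(x, \<sigma>)\<close> and \<open>(w, \<tau>)\<close> in \<open>F\<close>,
  going from \<open>y\<close> to \<open>z\<close> via \<open>x\<close> and \<open>w\<close> gives
  \<open>d y z \<le> (\<sigma> + d x y) + (\<tau> + d w z)\<close> by compatibility; the infimum
  over both pairs is the second property.\<close>

lemma (in Metric_space) extend_radii:
  assumes "F \<subseteq> M \<times> {0..}" "F \<noteq> {}"
    and compat: "\<And>x \<sigma> y \<tau>. \<lbrakk>(x, \<sigma>) \<in> F; (y, \<tau>) \<in> F\<rbrakk> \<Longrightarrow> d x y \<le> \<sigma> + \<tau>"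
  obtains \<rho> where "\<And>y. 0 \<le> \<rho> y"
    and "\<And>y z. \<lbrakk>y \<in> M; z \<in> M\<rbrakk> \<Longrightarrow> d y z \<le> \<rho> y + \<rho> z"
    and "\<And>x \<sigma>. (x, \<sigma>) \<in> F \<Longrightarrow> \<rho> x \<le> \<sigma>"
proof
  define \<rho> where "\<rho> y = (INF (x, \<sigma>)\<in>F. \<sigma> + d x y)" for y
  have ge: "c \<le> \<rho> y" if "\<And>x \<sigma>. (x, \<sigma>) \<in> F \<Longrightarrow> c \<le> \<sigma> + d x y" for c y
    unfolding \<rho>_def by (rule cINF_greatest) (use assms(2) that in auto)
  show "0 \<le> \<rho> y" for y
    by (rule ge) (use assms(1) in auto)
  show "d y z \<le> \<rho> y + \<rho> z" if "y \<in> M" "z \<in> M" for y z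
  proof -
    \<comment> \<open>The two infima are taken one after the other: with
      \<open>(x, \<sigma>)\<close> fixed, \<open>(w, \<tau>)\<close> varies first.\<close>
    have "d y z - \<rho> z \<le> \<sigma> + d x y" if "(x, \<sigma>) \<in> F" for x \<sigma>
    proof -
      have "d y z - (\<sigma> + d x y) \<le> \<tau> + d w z" if "(w, \<tau>) \<in> F" for w \<tau>
      proof -
        have "x \<in> M" "w \<in> M"
          using \<open>(x, \<sigma>) \<in> F\<close> \<open>(w, \<tau>) \<in> F\<close> assms(1) by auto
        then have "d y z \<le> d x y + d x w + d w z"
          using triangle[of y x z] triangle[of x w z] \<open>y \<in> M\<close> \<open>z \<in> M\<close> commute[of x y] by simp
        with compat[OF \<open>(x, \<sigma>) \<in> F\<close> \<open>(w, \<tau>) \<in> F\<close>] show ?thesis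
          by simp
      qed
      then have "d y z - (\<sigma> + d x y) \<le> \<rho> z"
        by (rule ge)
      then show ?thesis by simp
    qed
    then have "d y z - \<rho> z \<le> \<rho> y"
      by (rule ge)
    then show ?thesis by simp
  qed
  show "\<rho> x \<le> \<sigma>" if "(x, \<sigma>) \<in> F" for x \<sigma>
  proof -
    \<comment> \<open>With a lower bound, the infimum is at most its term at
      \<open>(x, \<sigma>)\<close>, which is \<sigma> because \<open>d x x = 0\<close>.\<close>
    have "bdd_below ((\<lambda>(w, \<tau>). \<tau> + d w x) ` F)"
      by (rule bdd_belowI[of _ 0]) (use assms(1) in auto)
    from cINF_lower[OF this that] have "\<rho> x \<le> \<sigma> + d x x"
      by (simp add: \<rho>_def)
    moreover have "x \<in> M"
      using that assms(1) by auto
    ultimately show ?thesis by simp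
  qed
qed

theorem proposition3p3:
  fixes X :: "'a set" and \<delta> :: "'a set \<Rightarrow> real"
  assumes "hyperconvex_diversity X \<delta>"
    and "\<And>A (n :: nat) (x :: nat \<Rightarrow> 'a). \<lbrakk>A \<in> Fpow X; bij_betw x {1..n} A\<rbrakk> \<Longrightarrow>
      (real (card A) - 1) * \<delta> A
        \<le> (\<Sum>(i, j)\<in>{(i, j). 1 \<le> i \<and> i < j \<and> j \<le> n}. induced_metric X \<delta> (x i) (x j))"
  shows "hyperconvex_metric_space X (induced_metric X \<delta>)"
proof -
  interpret hyperconvex_diversity X \<delta> by fact
  interpret Metric_space X "induced_metric X \<delta>"
    by (rule Metric_space_induced_metric)
  \<comment> \<open>\<rho> is left arbitrary because two choices are used: zero radii for an empty
    family, extended radii otherwise.\<close>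
  have common: "\<exists>z\<in>X. \<forall>Y\<in>Fpow X. \<delta> ({z} \<union> Y) \<le> sum \<rho> Y"
    if \<rho>: "\<And>y. 0 \<le> \<rho> y"
      "\<And>y z. \<lbrakk>y \<in> X; z \<in> X\<rbrakk> \<Longrightarrow> induced_metric X \<delta> y z \<le> \<rho> y + \<rho> z" for \<rho>
  proof (rule hyperconvex)
    fix \<A> assume \<A>: "finite \<A>" "\<A> \<subseteq> Fpow X"
    then have UN: "\<Union>\<A> \<in> Fpow X"
      by (auto simp: Fpow_def)
    then have "\<delta> (\<Union>\<A>) \<le> sum \<rho> (\<Union>\<A>)"
      by (intro le_sum_radii assms(2) \<rho>) (auto simp: Fpow_def)
    also have "\<dots> \<le> (\<Sum>A\<in>\<A>. sum \<rho> A)"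
      by (rule sum_Union_le) (use \<A> \<rho> in \<open>auto simp: Fpow_def\<close>)
    finally show "\<delta> (\<Union>\<A>) \<le> (\<Sum>A\<in>\<A>. sum \<rho> A)" .
  qed simp
  show ?thesis
  proof
    fix F
    assume F: "F \<subseteq> X \<times> {0..}"
      and compat: "\<And>x \<sigma> y \<tau>. \<lbrakk>(x, \<sigma>) \<in> F; (y, \<tau>) \<in> F\<rbrakk> \<Longrightarrow> induced_metric X \<delta> x y \<le> \<sigma> + \<tau>"
    show "\<exists>z\<in>X. \<forall>(x, \<sigma>)\<in>F. z \<in> mcball x \<sigma>"
    proof (cases "F = {}")
      case True
      \<comment> \<open>An empty family only asks for some point of \<open>X\<close>. Were
        \<open>X\<close> empty, zero radii would satisfy both conditions of \<open>common\<close>,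
        which would still produce a point.\<close>
      have "X \<noteq> {}"
      proof
        assume "X = {}"
        then have "induced_metric X \<delta> = (\<lambda>_ _. 0)"
          by (simp add: induced_metric_def fun_eq_iff)
        then show False
          using common[of "\<lambda>_. 0"] \<open>X = {}\<close> by simp
      qed
      then show ?thesis
        using True by auto
    next
      case False
      obtain \<rho> where \<rho>: "\<And>y. 0 \<le> \<rho> y"
          "\<And>y z. \<lbrakk>y \<in> X; z \<in> X\<rbrakk> \<Longrightarrow> induced_metric X \<delta> y z \<le> \<rho> y + \<rho> z"
        and radius: "\<And>x \<sigma>. (x, \<sigma>) \<in> F \<Longrightarrow> \<rho> x \<le> \<sigma>"
        using extend_radii[OF F False compat] by blast
      obtain z where z: "z \<in> X" "\<forall>Y\<in>Fpow X. \<delta> ({z} \<union> Y) \<le> sum \<rho> Y"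
        using common[OF \<rho>] by blast
      have "z \<in> mcball x \<sigma>" if "(x, \<sigma>) \<in> F" for x \<sigma>
      proof -
        have "x \<in> X"
          using that F by auto
        then have "\<delta> {x, z} \<le> \<rho> x"
          using bspec[OF z(2), of "{x}"] by (simp add: Fpow_def insert_commute)
        with radius[OF that] \<open>x \<in> X\<close> z(1) show ?thesis
          by (simp add: induced_metric_def)
      qed
      with z(1) show ?thesis by blast
    qed
  qed
qed

end
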